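(* Let $L$ be a field of characteristic $0$, and let $$F(\lambda)=\frac{P(\lambda)}{\prod_{1\le i\le n}(\lambda^{j_i}-z_i)}\in L(\lambda),$$ where $P(\lambda)\in L[\lambda]$, the $j_i$ are positive integers, $z_i\in L$, and the factors $\lambda^{j_i}-z_i$ are pairwise relatively prime in $L[\lambda]$. Let $$F=f(\lambda)+\sum_{1\le i\le n}\frac{p_i(\lambda)}{\lambda^{j_i}-z_i}$$ be the partial fraction decomposition, with $f,p_i\in L[\lambda]$ and $\deg p_i<j_i$. Then for each $s$ with $1\le s\le n$, $p_s(\lambda)$ equals the remainder of $$P(\lambda)\prod_{1\le i\le n,\ i\ne s}\mathcal F(\lambda^{j_s}-z_s,\lambda^{j_i}-z_i)$$ when divided by $\lambda^{j_s}-z_s$ as a polynomial in $\lambda$.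
   Context: For positive integers $j,k$ and $a,b\in L$ such that $\lambda^j-a$ and $\lambda^k-b$ are relatively prime, put $j'=j/\gcd(j,k)$, $k'=k/\gcd(j,k)$ and $$\mathcal F(\lambda^j-a,\lambda^k-b)=\frac{\sum_{i=0}^{j'-1}\lambda^{ik}\,b^{\,j'-1-i}}{a^{k'}-b^{j'}}\in L[\lambda]$$ (the denominator is nonzero under the relative primality assumption; $0^0=1$). *)

theory Defs
  imports "HOL-Computational_Algebra.Computational_Algebra"
begin

definition binom_factor :: "nat \<Rightarrow> 'a::field \<Rightarrow> 'a poly" where
  "binom_factor j a = monom 1 j - [:a:]"

text \<open>
  For \<open>j > 0\<close> the pair \<open>(j, a)\<close> is determined by the polynomial \<open>\<lambda>^j - a\<close>, so
  \<open>calF j a k b\<close> stands for \<open>\<F>(\<lambda>^j - a, \<lambda>^k - b)\<close>.  It is meaningful only when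
  \<open>j, k > 0\<close> and the two polynomials are coprime, which makes \<open>a^k' - b^j'\<close> nonzero.
\<close>

definition calF :: "nat \<Rightarrow> 'a::field \<Rightarrow> nat \<Rightarrow> 'a \<Rightarrow> 'a poly" where
  "calF j a k b =
     (let j' = j div gcd j k; k' = k div gcd j k
      in smult (1 / (a ^ k' - b ^ j')) (\<Sum>i<j'. monom (b ^ (j' - 1 - i)) (i * k)))"

end

(* Modulo \<lambda>^j - a the power \<lambda>^(lcm j k) equals a^k', so the geometric sum identity
   shows that F(\<lambda>^j - a, \<lambda>^k - b) is an inverse of \<lambda>^k - b modulo \<lambda>^j - a. Its
   denominator a^k' - b^j' is nonzero: otherwise a = c^j' and b = c^k' for some c in the field
   itself, as j' and k' are coprime, and \<lambda>^(gcd j k) - c divides both factors. Clearing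
   denominators in the partial fraction decomposition and reducing modulo \<lambda>^(j_s) - z_s
   leaves P = p_s * (product of the other factors), which is then solved for p_s. *)
theory Submission
  imports Defs "HOL-Number_Theory.Cong"
begin

text \<open>With x = \<lambda>^g this is x - c dividing x^m - c^m. It serves twice: with g a gcd it
  yields a common divisor of two factors, and with g = j it reduces powers of \<lambda>^j.\<close>

lemma binom_factor_dvd:
  "binom_factor g (c::'a::field) dvd monom 1 (g * m) - [:c ^ m:]"
proof -
  have "monom 1 (g * m) - [:c ^ m:] = (monom 1 g) ^ m - [:c:] ^ m"
    by (simp add: monom_power poly_const_pow)
  also have "binom_factor g c dvd \<dots>"
    unfolding binom_factor_def by (subst power_diff_sumr2) simp
  finally show ?thesis .
qed

lemma degree_binom_factor: "0 < j \<Longrightarrow> degree (binom_factor j a) = j"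
  unfolding binom_factor_def
  by (subst diff_conv_add_uminus, subst degree_add_eq_left) (simp_all add: degree_monom_eq)

text \<open>If j u - k v = 1, then c = a^u / b^v works: substituting a^k = b^j turns c^j into a^(j u
  - k v) and c^k into b^(j u - k v). The division by b^v is why a = b = 0 is treated apart, with c =
  0.\<close>

lemma common_root_of_coprime_exponents:
  fixes a b :: "'a::field"
  assumes "coprime j k" "0 < j" "0 < k" "a ^ k = b ^ j"
  obtains c where "c ^ j = a" "c ^ k = b"
proof (cases "a = 0")
  case True
  with assms have "b = 0" by (auto simp: power_0_left)
  with True assms that[of 0] show ?thesis by (simp add: power_0_left)
next
  case False
  with assms have "b \<noteq> 0" by (metis power_eq_0_iff)
  obtain u v where uv: "j * u = k * v + 1"
    using bezout_nat[of j k] assms by auto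
  have "(a ^ u / b ^ v) ^ j = a ^ (j * u) / (b ^ j) ^ v"
    by (simp add: power_divide mult.commute flip: power_mult)
  also have "\<dots> = a"
    using False by (simp add: uv power_mult power_add flip: assms(4))
  finally have 1: "(a ^ u / b ^ v) ^ j = a" .
  have "(a ^ u / b ^ v) ^ k = (a ^ k) ^ u / b ^ (k * v)"
    by (simp add: power_divide mult.commute flip: power_mult)
  also have "\<dots> = b ^ (j * u) / b ^ (k * v)"
    by (simp add: assms(4) power_mult)
  also have "\<dots> = b"
    using \<open>b \<noteq> 0\<close> by (simp add: uv)
  finally show ?thesis using 1 that by blast
qed

lemma calF_denominator_nonzero:
  fixes a b :: "'a::field"
  assumes "0 < j" "0 < k" "coprime (binom_factor j a) (binom_factor k b)"
  shows "a ^ (k div gcd j k) \<noteq> b ^ (j div gcd j k)"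
proof
  let ?g = "gcd j k"
  assume eq: "a ^ (k div ?g) = b ^ (j div ?g)"
  have pos: "0 < ?g" "0 < j div ?g" "0 < k div ?g"
    using assms by (simp_all add: div_greater_zero_iff dvd_imp_le)
  have "coprime (j div ?g) (k div ?g)"
    using assms by (intro div_gcd_coprime) auto
  then obtain c where c: "c ^ (j div ?g) = a" "c ^ (k div ?g) = b"
    using common_root_of_coprime_exponents pos eq by metis
  have "binom_factor ?g c dvd binom_factor j a" "binom_factor ?g c dvd binom_factor k b"
    using binom_factor_dvd[of ?g c "j div ?g"] binom_factor_dvd[of ?g c "k div ?g"] c
    by (simp_all add: binom_factor_def)
  then have "is_unit (binom_factor ?g c)"
    using assms(3) by (rule coprime_common_divisor[rotated])
  \<comment> \<open>The common divisor has degree \<open>gcd j k\<close> > 0, so it cannot be a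
    unit.\<close>
  then show False
    using pos(1) degree_binom_factor[of ?g c]
    by (cases "binom_factor ?g c = 0") (auto simp: is_unit_iff_degree)
qed

lemma calF_inverse:
  fixes a b :: "'a::field"
  assumes "0 < j" "0 < k" "coprime (binom_factor j a) (binom_factor k b)"
  shows "[calF j a k b * binom_factor k b = 1] (mod binom_factor j a)"
proof -
  let ?j' = "j div gcd j k" and ?k' = "k div gcd j k"
  let ?D = "a ^ ?k' - b ^ ?j'"
  have "?D \<noteq> 0"
    using calF_denominator_nonzero assms by simp
  \<comment> \<open>Both products are the least common multiple of j and k.\<close>
  have exponents: "k * ?j' = j * ?k'"
    by (metis div_mult_swap dvd_div_mult gcd_dvd1 gcd_dvd2 mult.commute)
  have "calF j a k b * binom_factor k b =
      smult (1 / ?D) ((monom 1 k - [:b:]) * (\<Sum>i<?j'. [:b:] ^ (?j' - Suc i) * monom 1 k ^ i))"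
    unfolding calF_def binom_factor_def Let_def
    by (simp add: monom_power poly_const_pow smult_monom mult.commute)
  also have "\<dots> = smult (1 / ?D) (monom 1 k ^ ?j' - [:b:] ^ ?j')"
    by (simp only: power_diff_sumr2)
  \<comment> \<open>Trading the constant b^j' for a^k' leaves a multiple of \<lambda>^j - a plus the
    constant \<open>?D\<close>, which the scaling turns into 1.\<close>
  also have "\<dots> = smult (1 / ?D) ((monom 1 (j * ?k') - [:a ^ ?k':]) + [:?D:])"
    by (rule arg_cong[where f = "smult _"], rule poly_eqI)
      (simp add: monom_power poly_const_pow exponents coeff_pCons split: nat.split)
  also have "\<dots> = smult (1 / ?D) (monom 1 (j * ?k') - [:a ^ ?k':]) + 1"
    using \<open>?D \<noteq> 0\<close> by (simp add: smult_add_right one_pCons)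
  finally have "calF j a k b * binom_factor k b - 1 =
      smult (1 / ?D) (monom 1 (j * ?k') - [:a ^ ?k':])"
    by simp
  then show ?thesis
    by (simp add: cong_iff_dvd_diff dvd_smult binom_factor_dvd)
qed

text \<open>Multiplying by the common denominator and using injectivity of \<open>to_fract\<close>
  moves the decomposition from the fraction field into the ring, where congruences make
  sense.\<close>

lemma partial_fractions_clear_denominators:
  fixes P f :: "'a::idom" and p q :: "'b \<Rightarrow> 'a"
  assumes "finite A" "\<And>i. i \<in> A \<Longrightarrow> q i \<noteq> 0"
    and "to_fract P / to_fract (prod q A) = to_fract f + (\<Sum>i\<in>A. to_fract (p i) / to_fract (q i))"
  shows "P = f * prod q A + (\<Sum>i\<in>A. p i * prod q (A - {i}))"
proof -
  have "prod q A \<noteq> 0"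
    using assms by simp
  have summand: "to_fract (p i) / to_fract (q i) * to_fract (prod q A) =
      to_fract (p i * prod q (A - {i}))" if "i \<in> A" for i
    using assms(1,2) that by (simp add: prod.remove[of A i])
  have "to_fract P = to_fract P / to_fract (prod q A) * to_fract (prod q A)"
    using \<open>prod q A \<noteq> 0\<close> by simp
  also have "\<dots> = to_fract (f * prod q A + (\<Sum>i\<in>A. p i * prod q (A - {i})))"
    unfolding assms(3) distrib_right sum_distrib_right to_fract_add to_fract_sum to_fract_mult[of f]
    by (rule arg_cong[where f = "(+) _"]) (rule sum.cong[OF refl summand])
  finally show ?thesis
    by (simp only: to_fract_eq_iff)
qed

theorem mainTheorem15:
  fixes n :: nat
    and j :: "nat \<Rightarrow> nat"
    and z :: "nat \<Rightarrow> 'a::field_char_0"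
    and P f :: "'a poly"
    and p :: "nat \<Rightarrow> 'a poly"
    and F :: "'a poly fract"
    and s :: nat
  assumes j_pos: "\<And>i. i \<in> {1..n} \<Longrightarrow> 0 < j i"
    and coprime_factors:
      "\<And>i k. i \<in> {1..n} \<Longrightarrow> k \<in> {1..n} \<Longrightarrow> i \<noteq> k \<Longrightarrow>
        coprime (binom_factor (j i) (z i)) (binom_factor (j k) (z k))"
    and F_eq: "F = to_fract P / to_fract (\<Prod>i=1..n. binom_factor (j i) (z i))"
    and partial_fractions:
      "F = to_fract f + (\<Sum>i=1..n. to_fract (p i) / to_fract (binom_factor (j i) (z i)))"
    and degree_p: "\<And>i. i \<in> {1..n} \<Longrightarrow> degree (p i) < j i"
    and s: "s \<in> {1..n}"
  shows "p s = (P * (\<Prod>i\<in>{1..n} - {s}. calF (j s) (z s) (j i) (z i)))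
               mod binom_factor (j s) (z s)"
proof -
  let ?q = "\<lambda>i. binom_factor (j i) (z i)"
  let ?B = "{1..n} - {s}"
  have q_nonzero: "?q i \<noteq> 0" if "i \<in> {1..n}" for i
    using degree_binom_factor[of "j i" "z i"] j_pos[OF that] by force
  have "P = f * prod ?q {1..n} + (\<Sum>i\<in>{1..n}. p i * prod ?q ({1..n} - {i}))"
    using partial_fractions_clear_denominators[of "{1..n}" ?q P f p] q_nonzero
      F_eq partial_fractions by simp
  also have "\<dots> = f * prod ?q {1..n} + (\<Sum>i\<in>?B. p i * prod ?q ({1..n} - {i})) + p s * prod ?q ?B"
    using sum.remove[OF _ s, of "\<lambda>i. p i * prod ?q ({1..n} - {i})"] by simp
  \<comment> \<open>The polynomial part and every summand with index other than s contain the factor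
    \<open>?q s\<close>.\<close>
  also have "[\<dots> = 0 + p s * prod ?q ?B] (mod ?q s)"
    using s by (intro cong_add cong_refl)
      (auto simp: cong_0_iff intro!: dvd_add dvd_mult dvd_sum dvd_prodI)
  finally have "[P * (\<Prod>i\<in>?B. calF (j s) (z s) (j i) (z i)) =
      p s * prod ?q ?B * (\<Prod>i\<in>?B. calF (j s) (z s) (j i) (z i))] (mod ?q s)"
    by (intro cong_mult cong_refl) simp
  \<comment> \<open>Each \<open>?q i\<close> is paired with its inverse modulo
    \<open>?q s\<close>.\<close>
  also have "p s * prod ?q ?B * (\<Prod>i\<in>?B. calF (j s) (z s) (j i) (z i)) =
      p s * (\<Prod>i\<in>?B. calF (j s) (z s) (j i) (z i) * ?q i)"
    by (simp add: prod.distrib mult_ac)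
  also have "[\<dots> = p s * (\<Prod>i\<in>?B. 1)] (mod ?q s)"
    using s by (intro cong_mult cong_refl cong_prod calF_inverse j_pos coprime_factors) auto
  \<comment> \<open>Since \<open>p s\<close> has smaller degree than \<open>?q s\<close>, it is its
    own remainder.\<close>
  finally show ?thesis
    using degree_p[OF s] degree_binom_factor[OF j_pos[OF s], of "z s"]
    by (simp add: cong_def mod_poly_less)
qed

end
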